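(* Let $d\ge2$, let $N=d+2$ and let $X=\{x_1,\dots,x_N\}$ be a non-degenerate stationary logarithmic configuration on $\mathbb{S}^{d-1}$. Suppose there is no point $x\in X$ that is equidistant to all other points in $X$. Then $X$ can be split into two (disjoint) sets such that these sets are the vertex sets of two regular simplexes that are orthogonal to each other and whose centers of mass are both at the center (the origin) of $\mathbb{S}^{d-1}$.
   Context: $\mathbb{S}^{d-1}$ is the unit sphere in $\mathbb{R}^d$. A configuration is a set $X=\{x_1,\dots,x_N\}\subset\mathbb{S}^{d-1}$ of $N$ distinct points; its logarithmic energy is $E_{\log}(X)=\sum_{1\le i\ne j\le N}\log\frac{1}{|x_i-x_j|}$. $X$ is a stationary logarithmic configuration if $(x_1,\dots,x_N)$ is a critical point of $E_{\log}$ on $(\mathbb{S}^{d-1})^N$; equivalently (Lagrange multipliers), $\sum_{j\ne i}\frac{x_i-x_j}{1-x_i\cdot x_j}=(N-1)x_i$ for $i=1,\dots,N$. $X$ is non-degenerate if $\mathrm{span}(X)=\mathbb{R}^d$. A point $x\in X$ is equidistant to all other points of $X$ if $|x-y|$ takes the same value for all $y\in X\setminus\{x\}$. A regular simplex is a set of points with all pairwise distances equal. Two sets $Y,Z$ are orthogonal to each other if $y\cdot z=0$ for all $y\in Y$, $z\in Z$. *)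

theory Defs
  imports "HOL-Analysis.Analysis"
begin

text \<open>
  An ordered configuration $(x_1, \dots, x_N)$ in $\mathbb{R}^d$ is a value of type
  \<^typ>\<open>(real^'d)^'n\<close> with $N$ = \<^term>\<open>CARD('n)\<close> and $d$ = \<^term>\<open>CARD('d)\<close>.
\<close>

definition sphere_power :: "((real^'d)^'n) set" where
  "sphere_power = {x. \<forall>i. x $ i \<in> sphere 0 1}"

definition log_energy :: "(real^'d)^'n \<Rightarrow> real" where
  "log_energy x = (\<Sum>(i, j)\<in>{(i, j). i \<noteq> j}. ln (1 / norm (x $ i - x $ j)))"

text \<open>
  A critical point of a function on a submanifold \<open>M\<close>: the derivative vanishes along every curve
  in \<open>M\<close> through \<open>p\<close>.  Since curves need only be differentiable at 0, a curve defined only near 0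
  extends to one defined on all reals (by the constant \<open>p\<close>), so taking total curves is no
  restriction.  The function \<open>f\<close> is not presumed differentiable at \<open>p\<close>: the derivatives along
  curves are asserted to exist and be 0.
\<close>

definition critical_point_on :: "'a::real_normed_vector set \<Rightarrow> ('a \<Rightarrow> real) \<Rightarrow> 'a \<Rightarrow> bool" where
  "critical_point_on M f p \<longleftrightarrow>
     p \<in> M \<and>
     (\<forall>\<gamma> :: real \<Rightarrow> 'a. \<gamma> 0 = p \<and> (\<forall>t. \<gamma> t \<in> M) \<and> \<gamma> differentiable (at 0) \<longrightarrow>
        ((\<lambda>t. f (\<gamma> t)) has_real_derivative 0) (at 0))"

text \<open>
  Distinctness of the points is part of the notion of a configuration; without it the convention
  \<^term>\<open>ln (1 / 0 :: real) = 0\<close> would hide the singularities of the energy.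
\<close>

definition stationary_log_configuration :: "(real^'d)^'n \<Rightarrow> bool" where
  "stationary_log_configuration x \<longleftrightarrow>
     inj (\<lambda>i. x $ i) \<and> critical_point_on sphere_power log_energy x"

definition non_degenerate :: "(real^'d) set \<Rightarrow> bool" where
  "non_degenerate X \<longleftrightarrow> span X = UNIV"

definition equidistant_to_others :: "'a::metric_space \<Rightarrow> 'a set \<Rightarrow> bool" where
  "equidistant_to_others x X \<longleftrightarrow> (\<exists>r. \<forall>y\<in>X - {x}. dist x y = r)"

definition regular_simplex :: "'a::metric_space set \<Rightarrow> bool" where
  "regular_simplex Y \<longleftrightarrow>
     finite Y \<and> Y \<noteq> {} \<and> (\<exists>r. \<forall>y\<in>Y. \<forall>z\<in>Y. y \<noteq> z \<longrightarrow> dist y z = r)"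

definition orthogonal_sets :: "'a::real_inner set \<Rightarrow> 'a set \<Rightarrow> bool" where
  "orthogonal_sets Y Z \<longleftrightarrow> (\<forall>y\<in>Y. \<forall>z\<in>Z. y \<bullet> z = 0)"

definition center_of_mass :: "'a::real_vector set \<Rightarrow> 'a" where
  "center_of_mass Y = (1 / real (card Y)) *\<^sub>R (\<Sum>y\<in>Y. y)"

end

theory Submission
  imports Defs
begin

text \<open>
  Write \<open>N\<close> for the number of points and put \<open>a i k = 1 / (1 - x $ i \<bullet> x $ k)\<close>.  Stationarity of
  the energy is the balance \<open>(\<Sum>k\<noteq>i. a i k *\<^sub>R (x $ i - x $ k)) = (N - 1) *\<^sub>R x $ i\<close>, and adding
  all balances gives \<open>(\<Sum>i. x $ i) = 0\<close>.

  With a suitable diagonal, the numbers \<open>a i k\<close> form a symmetric matrix whose rows are linear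
  relations between the points.  Since \<open>N = d + 2\<close> points spanning a space of dimension \<open>d\<close> satisfy
  only a two-dimensional space of relations, and the constant vector is one of them, the matrix is
  determined by a single further relation \<open>v\<close> with coefficient sum zero:
  \<open>a i k = (N - 1) / N * (1 + \<mu> * (v $ i * v $ k))\<close> for \<open>i \<noteq> k\<close>
  (\<open>balanced_couplings_rank_one\<close>).  So the inner product of two points depends only on the product
  of their weights.  If no point is equidistant to the others, then \<open>\<mu>\<close> and all weights are nonzero.

  Taking the inner product of \<open>(\<Sum>k. x $ k) = 0\<close> with \<open>x $ i\<close> turns the geometry into a system of
  scalar equations, \<open>(\<Sum>k\<noteq>i. 1 / (1 + \<mu> * (v $ i * v $ k))) = N - 1\<close>.  Its second-order form
  (\<open>weights_second_order\<close>) excludes \<open>\<mu> > 0\<close>, so after rescaling the denominators are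
  \<open>1 - w i * w k\<close>; it also gives \<open>\<bar>w i\<bar> < 1\<close> (\<open>weights_less_one\<close>).  Now all weights \<open>t = w i\<close>
  solve the same equation \<open>(\<Sum>k. (1 - (w k)\<^sup>2) / (1 - t * w k)) = N - 1\<close>, in which \<open>k = i\<close> is no
  longer left out.  Its left-hand side is strictly convex in \<open>t\<close>, so there are at most two weights,
  and as their sum is zero there are exactly two, of opposite signs (\<open>weights_two_valued\<close>).

  The two classes of points with equal weight are the simplexes: inner products are constant within
  each class and between the classes, and the relations \<open>(\<Sum>i. x $ i) = 0\<close> and
  \<open>(\<Sum>i. w i *\<^sub>R x $ i) = 0\<close> force each class to have sum zero, hence the classes to be orthogonal
  (\<open>two_valued_weights_split\<close>).
\<close>

section \<open>Stationarity as a balance of forces\<close>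

lemma has_real_derivative_ln_inverse_norm:
  fixes f :: "real \<Rightarrow> 'a::real_inner"
  assumes "(f has_vector_derivative f') (at t)" and "f t \<noteq> 0"
  shows "((\<lambda>s. ln (1 / norm (f s))) has_real_derivative - (f t \<bullet> f') / (norm (f t))\<^sup>2) (at t)"
proof -
  have "((\<lambda>s. norm (f s)) has_derivative (\<lambda>h. (h *\<^sub>R f') \<bullet> sgn (f t))) (at t)"
    using has_derivative_compose[OF assms(1)[unfolded has_vector_derivative_def]
        has_derivative_norm[OF assms(2)]] .
  moreover have "(\<lambda>h. (h *\<^sub>R f') \<bullet> sgn (f t)) = (*) ((f t \<bullet> f') / norm (f t))"
    by (simp add: fun_eq_iff sgn_div_norm inner_commute divide_inverse mult_ac)
  ultimately have "((\<lambda>s. norm (f s)) has_real_derivative (f t \<bullet> f') / norm (f t)) (at t)"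
    by (simp add: has_field_derivative_def)
  then have "((\<lambda>s. - ln (norm (f s))) has_real_derivative
      - (1 / norm (f t) * ((f t \<bullet> f') / norm (f t)))) (at t)"
    using assms(2) by (auto intro!: derivative_eq_intros)
  moreover have "ln (1 / norm y) = - ln (norm y)" for y :: 'a
    by (cases "y = 0") (simp_all add: ln_div)
  ultimately show ?thesis
    by (simp add: power2_eq_square)
qed

text \<open>
  The energy counts every unordered pair twice, and both copies react in the same way when a
  single point moves; hence the factor 2.
\<close>

lemma log_energy_has_derivative_along:
  fixes x :: "(real^'d)^'n"
  assumes "inj (\<lambda>i. x $ i)"
    and "\<gamma> 0 = x"
    and "\<And>j. ((\<lambda>t. \<gamma> t $ j) has_vector_derivative (if j = i then h else 0)) (at 0)"
  shows "((\<lambda>t. log_energy (\<gamma> t)) has_real_derivative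
    - 2 * (\<Sum>k\<in>-{i}. ((x $ i - x $ k) \<bullet> h) / (norm (x $ i - x $ k))\<^sup>2)) (at 0)"
proof -
  define \<delta> where "\<delta> j = (if j = i then h else 0)" for j
  define F where "F j k = ((x $ j - x $ k) \<bullet> \<delta> j) / (norm (x $ j - x $ k))\<^sup>2" for j k
  let ?P = "{(j, k). j \<noteq> k} :: ('n \<times> 'n) set"
  have "((\<lambda>t. ln (1 / norm (\<gamma> t $ j - \<gamma> t $ k))) has_real_derivative - (F j k + F k j)) (at 0)"
    if "j \<noteq> k" for j k
  proof -
    have "((\<lambda>t. \<gamma> t $ j - \<gamma> t $ k) has_vector_derivative \<delta> j - \<delta> k) (at 0)"
      unfolding \<delta>_def by (intro has_vector_derivative_diff assms(3))
    moreover have "\<gamma> 0 $ j - \<gamma> 0 $ k \<noteq> 0"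
      using assms(1,2) that by (auto simp: inj_eq)
    ultimately have "((\<lambda>t. ln (1 / norm (\<gamma> t $ j - \<gamma> t $ k))) has_real_derivative
        - ((\<gamma> 0 $ j - \<gamma> 0 $ k) \<bullet> (\<delta> j - \<delta> k)) / (norm (\<gamma> 0 $ j - \<gamma> 0 $ k))\<^sup>2) (at 0)"
      by (rule has_real_derivative_ln_inverse_norm)
    moreover have "- ((\<gamma> 0 $ j - \<gamma> 0 $ k) \<bullet> (\<delta> j - \<delta> k)) / (norm (\<gamma> 0 $ j - \<gamma> 0 $ k))\<^sup>2
        = - (F j k + F k j)"
      unfolding F_def norm_minus_commute[of "x $ k" "x $ j"] assms(2)
      by (simp add: inner_diff_left inner_diff_right add_divide_distrib[symmetric]
          minus_divide_left)
    ultimately show ?thesis by simp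
  qed
  then have "((\<lambda>t. \<Sum>p\<in>?P. case p of (j, k) \<Rightarrow> ln (1 / norm (\<gamma> t $ j - \<gamma> t $ k)))
      has_real_derivative (\<Sum>p\<in>?P. case p of (j, k) \<Rightarrow> - (F j k + F k j))) (at 0)"
    by (intro DERIV_sum) auto
  moreover have "(\<Sum>p\<in>?P. case p of (j, k) \<Rightarrow> - (F j k + F k j))
      = - 2 * (\<Sum>k\<in>-{i}. ((x $ i - x $ k) \<bullet> h) / (norm (x $ i - x $ k))\<^sup>2)"
  proof -
    have P: "?P = Sigma UNIV (\<lambda>j. -{j})" by auto
    have swap: "(\<Sum>(j, k)\<in>?P. F k j) = (\<Sum>(j, k)\<in>?P. F j k)"
      by (rule sum.reindex_bij_witness[of _ prod.swap prod.swap]) auto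
    have "(\<Sum>(j, k)\<in>?P. F j k) = (\<Sum>j\<in>UNIV. \<Sum>k\<in>-{j}. F j k)"
      unfolding P by (rule sum.Sigma[symmetric]) auto
    also have "\<dots> = (\<Sum>j\<in>UNIV. if j = i then \<Sum>k\<in>-{i}. F i k else 0)"
      by (intro sum.cong) (auto simp: F_def \<delta>_def)
    also have "\<dots> = (\<Sum>k\<in>-{i}. F i k)" by simp
    finally have "(\<Sum>(j, k)\<in>?P. F j k) = (\<Sum>k\<in>-{i}. F i k)" .
    moreover have "(\<Sum>p\<in>?P. case p of (j, k) \<Rightarrow> - (F j k + F k j))
        = - ((\<Sum>(j, k)\<in>?P. F j k) + (\<Sum>(j, k)\<in>?P. F k j))"
      by (simp only: sum.distrib[symmetric] sum_negf[symmetric] split_def)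
    ultimately show ?thesis
      using swap by (simp add: F_def \<delta>_def)
  qed
  ultimately show ?thesis
    unfolding log_energy_def by simp
qed

lemma stationary_tangential:
  fixes x :: "(real^'d)^'n"
  assumes "stationary_log_configuration x" and "norm h = 1" and "x $ i \<bullet> h = 0"
  shows "(\<Sum>k\<in>-{i}. ((x $ i - x $ k) \<bullet> h) / (norm (x $ i - x $ k))\<^sup>2) = 0"
proof -
  have inj: "inj (\<lambda>i. x $ i)" and crit: "critical_point_on sphere_power log_energy x"
    using assms(1) unfolding stationary_log_configuration_def by auto
  have unit: "norm (x $ j) = 1" for j
    using crit by (simp add: critical_point_on_def sphere_power_def)
  \<comment> \<open>Rotate the \<open>i\<close>-th point along the great circle in direction \<open>h\<close> and keep the others fixed.\<close>
  define P :: "(real^'d)^'n" where "P = (\<chi> j. if j = i then x $ i else 0)"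
  define Q :: "(real^'d)^'n" where "Q = (\<chi> j. if j = i then 0 else x $ j)"
  define H :: "(real^'d)^'n" where "H = (\<chi> j. if j = i then h else 0)"
  define \<gamma> where "\<gamma> t = cos t *\<^sub>R P + sin t *\<^sub>R H + Q" for t :: real
  have \<gamma>_nth: "\<gamma> t $ j = (if j = i then cos t *\<^sub>R (x $ i) + sin t *\<^sub>R h else x $ j)" for t j
    by (simp add: \<gamma>_def P_def Q_def H_def)
  have "\<gamma> 0 = x" by (simp add: vec_eq_iff \<gamma>_nth)
  have "norm (cos t *\<^sub>R (x $ i) + sin t *\<^sub>R h) = 1" for t
  proof -
    have "(norm (cos t *\<^sub>R (x $ i) + sin t *\<^sub>R h))\<^sup>2
        = (cos t)\<^sup>2 * (norm (x $ i))\<^sup>2 + (sin t)\<^sup>2 * (norm h)\<^sup>2"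
      using assms(3) assms(3)[unfolded inner_commute[of _ h]]
      by (simp add: power2_norm_eq_inner inner_add_left inner_add_right) (simp add: power2_eq_square)
    also have "\<dots> = 1" using unit assms(2) by simp
    finally show ?thesis by (metis norm_ge_zero one_power2 power2_eq_iff_nonneg zero_le_one)
  qed
  then have "\<gamma> t \<in> sphere_power" for t
    using unit by (simp add: sphere_power_def \<gamma>_nth)
  moreover have "(\<gamma> has_vector_derivative H) (at 0)"
    unfolding \<gamma>_def by (auto intro!: derivative_eq_intros)
  then have "\<gamma> differentiable (at 0)"
    by (rule differentiableI_vector)
  ultimately have "((\<lambda>t. log_energy (\<gamma> t)) has_real_derivative 0) (at 0)"
    using crit \<open>\<gamma> 0 = x\<close> unfolding critical_point_on_def by blast
  moreover have "((\<lambda>t. \<gamma> t $ j) has_vector_derivative (if j = i then h else 0)) (at 0)" for j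
    unfolding \<gamma>_nth by (auto intro!: derivative_eq_intros)
  then have "((\<lambda>t. log_energy (\<gamma> t)) has_real_derivative
    - 2 * (\<Sum>k\<in>-{i}. ((x $ i - x $ k) \<bullet> h) / (norm (x $ i - x $ k))\<^sup>2)) (at 0)"
    by (rule log_energy_has_derivative_along[where \<gamma> = \<gamma>, OF inj \<open>\<gamma> 0 = x\<close>])
  ultimately show ?thesis
    using DERIV_unique by force
qed

lemma norm_diff_unit:
  fixes a b :: "'a::real_inner"
  assumes "norm a = 1" and "norm b = 1"
  shows "(norm (a - b))\<^sup>2 = 2 * (1 - a \<bullet> b)"
  using assms by (simp add: power2_norm_eq_inner inner_diff_left inner_diff_right
      inner_commute norm_eq_1)

lemma inner_less_one_if_unit:
  fixes a b :: "'a::real_inner"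
  assumes "norm a = 1" and "norm b = 1" and "a \<noteq> b"
  shows "a \<bullet> b < 1"
proof -
  have "0 < (norm (a - b))\<^sup>2" using assms(3) by simp
  then show ?thesis using norm_diff_unit[OF assms(1,2)] by simp
qed

text \<open>
  The tangential part of the resulting force at \<open>x $ i\<close> vanishes by stationarity.  Its radial part
  is fixed by the constraint: each summand has inner product 1 with \<open>x $ i\<close>.
\<close>

lemma stationary_balance:
  fixes x :: "(real^'d)^'n"
  assumes "stationary_log_configuration x"
  shows "(\<Sum>k\<in>-{i}. (1 / (1 - x $ i \<bullet> x $ k)) *\<^sub>R (x $ i - x $ k)) = (real CARD('n) - 1) *\<^sub>R x $ i"
proof -
  have inj: "inj (\<lambda>i. x $ i)" and unit: "norm (x $ j) = 1" for j
    using assms by (auto simp: stationary_log_configuration_def critical_point_on_def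
        sphere_power_def)
  define V where "V = (\<Sum>k\<in>-{i}. (1 / (1 - x $ i \<bullet> x $ k)) *\<^sub>R (x $ i - x $ k))"
  define u where "u = V - (V \<bullet> x $ i) *\<^sub>R x $ i"
  have self: "x $ i \<bullet> x $ i = 1" using unit[of i] by (simp add: norm_eq_1)
  have "V \<bullet> x $ i = (\<Sum>k\<in>-{i}. 1)"
    unfolding V_def inner_sum_left
  proof (intro sum.cong refl)
    fix k assume "k \<in> -{i}"
    then have "x $ i \<bullet> x $ k < 1"
      using inj by (intro inner_less_one_if_unit unit) (auto simp: inj_eq)
    then show "(1 / (1 - x $ i \<bullet> x $ k)) *\<^sub>R (x $ i - x $ k) \<bullet> x $ i = 1"
      by (simp add: inner_diff_left self inner_commute[of "x $ k"])
  qed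
  also have "\<dots> = real CARD('n) - 1"
    by (simp add: Compl_eq_Diff_UNIV card_Diff_subset of_nat_diff Suc_leI)
  finally have Vx: "V \<bullet> x $ i = real CARD('n) - 1" .
  have ux: "x $ i \<bullet> u = 0"
    by (simp add: u_def inner_diff_right self inner_commute)
  have "u = 0"
  proof (rule ccontr)
    assume "u \<noteq> 0"
    have "(\<Sum>k\<in>-{i}. ((x $ i - x $ k) \<bullet> sgn u) / (norm (x $ i - x $ k))\<^sup>2) = 0"
      using \<open>u \<noteq> 0\<close> ux by (intro stationary_tangential assms) (auto simp: norm_sgn sgn_div_norm)
    moreover have "(\<Sum>k\<in>-{i}. ((x $ i - x $ k) \<bullet> sgn u) / (norm (x $ i - x $ k))\<^sup>2)
        = (V \<bullet> sgn u) / 2"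
      unfolding V_def inner_sum_left sum_divide_distrib norm_diff_unit[OF unit unit]
      by (intro sum.cong refl) simp
    ultimately have "V \<bullet> u = 0"
      using \<open>u \<noteq> 0\<close> by (simp add: sgn_div_norm)
    then have "u \<bullet> u = 0"
      using ux by (simp add: u_def inner_diff_left)
    then show False using \<open>u \<noteq> 0\<close> by simp
  qed
  then show ?thesis using Vx by (simp add: u_def V_def)
qed

section \<open>Linear relations between the points\<close>

text \<open>
  Each pair \<open>i \<noteq> k\<close> contributes opposite forces to the balances at \<open>i\<close> and at \<open>k\<close>, so adding all
  balances leaves only the right-hand sides.
\<close>

lemma balanced_sum_zero:
  fixes x :: "(real^'d)^'n" and a :: "'n \<Rightarrow> 'n \<Rightarrow> real"
  assumes "\<And>i k. a i k = a k i" and "m \<noteq> 0"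
    and "\<And>i. (\<Sum>k\<in>-{i}. a i k *\<^sub>R (x $ i - x $ k)) = m *\<^sub>R x $ i"
  shows "(\<Sum>i\<in>UNIV. x $ i) = 0"
proof -
  have "m *\<^sub>R (\<Sum>i\<in>UNIV. x $ i) = (\<Sum>i\<in>UNIV. \<Sum>k\<in>-{i}. a i k *\<^sub>R (x $ i - x $ k))"
    by (simp add: assms(3) scaleR_sum_right)
  also have "\<dots> = (\<Sum>i\<in>UNIV. \<Sum>k\<in>UNIV. a i k *\<^sub>R (x $ i - x $ k))"
    by (intro sum.cong refl sum.mono_neutral_left) auto
  also have "\<dots> = (\<Sum>i\<in>UNIV. \<Sum>k\<in>UNIV. a i k *\<^sub>R x $ i)
      - (\<Sum>i\<in>UNIV. \<Sum>k\<in>UNIV. a i k *\<^sub>R x $ k)"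
    by (simp add: scaleR_diff_right sum_subtractf)
  also have "(\<Sum>i\<in>UNIV. \<Sum>k\<in>UNIV. a i k *\<^sub>R x $ k) = (\<Sum>i\<in>UNIV. \<Sum>k\<in>UNIV. a i k *\<^sub>R x $ i)"
    by (subst sum.swap) (simp add: assms(1))
  finally show ?thesis using assms(2) by simp
qed

text \<open>
  Regard \<open>x\<close> as a matrix whose rows are the points: its coordinate columns span a space of
  dimension \<open>CARD('d)\<close>, and the linear relations between the rows are the vectors orthogonal to
  it.
\<close>

lemma dim_linear_relations:
  fixes x :: "(real^'d)^'n"
  assumes "span (range (\<lambda>i. x $ i)) = UNIV"
  shows "dim {u::real^'n. (\<Sum>i\<in>UNIV. u $ i *\<^sub>R x $ i) = 0} + CARD('d) = CARD('n)"
proof -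
  let ?R = "range (\<lambda>h. x *v h)"
  have R: "subspace ?R"
    by (intro linear_subspace_image matrix_vector_mul_linear subspace_UNIV)
  have "rows x = range (\<lambda>i. x $ i)"
    by (auto simp: rows_def row_def)
  then have "dim ?R = CARD('d)"
    by (metis assms row_rank_def rank_dim_range dim_span dim_UNIV DIM_cart DIM_real mult.right_neutral)
  moreover have "{u \<in> UNIV. \<forall>y\<in>?R. orthogonal y u} = {u. (\<Sum>i\<in>UNIV. u $ i *\<^sub>R x $ i) = 0}"
  proof -
    have "(x *v h) \<bullet> u = h \<bullet> (\<Sum>i\<in>UNIV. u $ i *\<^sub>R x $ i)" for h u
      unfolding inner_vec_def[of "x *v h"]
      by (simp add: matrix_vector_mul_component inner_sum_right inner_commute mult.commute)
    then show ?thesis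
      by (simp add: orthogonal_def all_zero_iff inner_commute[of _ "sum _ _"])
  qed
  ultimately show ?thesis
    using dim_subspace_orthogonal_to_vectors[OF R subspace_UNIV] by simp
qed

lemma linear_relations_basis:
  fixes x :: "(real^'d)^'n"
  assumes "span (range (\<lambda>i. x $ i)) = UNIV"
    and "CARD('n) = CARD('d) + 2"
    and "(\<Sum>i\<in>UNIV. x $ i) = 0"
  obtains v :: "real^'n" where "v \<noteq> 0" "(\<Sum>i\<in>UNIV. v $ i) = 0" "(\<Sum>i\<in>UNIV. v $ i *\<^sub>R x $ i) = 0"
    "\<And>u. (\<Sum>i\<in>UNIV. u $ i *\<^sub>R x $ i) = 0 \<Longrightarrow> \<exists>\<alpha> \<beta>. \<forall>j. u $ j = \<alpha> + \<beta> * v $ j"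
proof -
  define K where "K = {u::real^'n. (\<Sum>i\<in>UNIV. u $ i *\<^sub>R x $ i) = 0}"
  define e :: "real^'n" where "e = (\<chi> i. 1)"
  have K: "subspace K"
    unfolding K_def subspace_def
    by (simp add: scaleR_add_left sum.distrib)
      (simp only: scaleR_scaleR[symmetric] scaleR_sum_right[symmetric], simp)
  have dimK: "dim K = 2"
    using dim_linear_relations[OF assms(1)] assms(2) by (simp add: K_def)
  have eK: "e \<in> K" using assms(3) by (simp add: K_def e_def)
  have e0: "e \<noteq> 0" by (simp add: e_def vec_eq_iff)
  have "\<not> K \<subseteq> span {e}"
  proof
    assume "K \<subseteq> span {e}"
    then have "dim K \<le> card {e}" by (intro dim_le_card) auto
    then show False using dimK by simp
  qed
  then obtain z where z: "z \<in> K" "z \<notin> span {e}" by auto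
  define v where "v = z - ((z \<bullet> e) / (e \<bullet> e)) *\<^sub>R e"
  have ve: "v \<bullet> e = 0" using e0 by (simp add: v_def inner_diff_left)
  have vK: "v \<in> K" unfolding v_def using z eK K by (intro subspace_diff subspace_scale)
  have v0: "v \<noteq> 0"
  proof
    assume "v = 0"
    then have "z = ((z \<bullet> e) / (e \<bullet> e)) *\<^sub>R e" by (simp add: v_def)
    then show False using z(2) by (metis span_base span_scale singletonI)
  qed
  have ind: "independent {e, v}"
    using ve v0 e0 by (intro pairwise_orthogonal_independent)
      (auto simp: pairwise_def orthogonal_def inner_commute)
  have "e \<noteq> v" using ve e0 by auto
  then have spanK: "K \<subseteq> span {e, v}"
    using ind dimK eK vK by (intro card_ge_dim_independent) auto
  show thesis
  proof (rule that[OF v0])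
    show "(\<Sum>i\<in>UNIV. v $ i) = 0" using ve by (simp add: inner_vec_def e_def)
    show "(\<Sum>i\<in>UNIV. v $ i *\<^sub>R x $ i) = 0" using vK by (simp add: K_def)
    fix u :: "real^'n" assume "(\<Sum>i\<in>UNIV. u $ i *\<^sub>R x $ i) = 0"
    then have "u \<in> span {e, v}" using spanK by (auto simp: K_def)
    then obtain \<alpha> \<beta> where "u - \<alpha> *\<^sub>R e = \<beta> *\<^sub>R v"
      by (auto simp: span_insert)
    then have "u = \<alpha> *\<^sub>R e + \<beta> *\<^sub>R v" by (simp add: algebra_simps)
    then show "\<exists>\<alpha> \<beta>. \<forall>j. u $ j = \<alpha> + \<beta> * v $ j"
      by (auto simp: e_def)
  qed
qed

text \<open>
  Complete the couplings to a symmetric matrix \<open>B\<close> by putting on the diagonal what makes the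
  balances read \<open>B x = 0\<close>.  The rows of \<open>B\<close> are then linear relations between the points, so each
  one is a combination of the constant relation and \<open>v\<close>; its coefficient sum fixes the constant
  part, and symmetry forces the remaining part to be a multiple of \<open>v v\<^sup>T\<close>.
\<close>

lemma balanced_couplings_rank_one:
  fixes x :: "(real^'d)^'n" and a :: "'n \<Rightarrow> 'n \<Rightarrow> real"
  assumes sym: "\<And>i k. a i k = a k i"
    and balance: "\<And>i. (\<Sum>k\<in>-{i}. a i k *\<^sub>R (x $ i - x $ k)) = m *\<^sub>R x $ i"
    and "m \<noteq> 0"
    and "span (range (\<lambda>i. x $ i)) = UNIV"
    and "CARD('n) = CARD('d) + 2"
  obtains v :: "real^'n" and \<mu> :: real
  where "(\<Sum>i\<in>UNIV. v $ i) = 0" "(\<Sum>i\<in>UNIV. v $ i *\<^sub>R x $ i) = 0"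
    "\<And>i k. i \<noteq> k \<Longrightarrow> a i k = m / real CARD('n) * (1 + \<mu> * (v $ i * v $ k))"
proof -
  have sum0: "(\<Sum>i\<in>UNIV. x $ i) = 0"
    by (rule balanced_sum_zero[OF sym \<open>m \<noteq> 0\<close> balance])
  obtain v :: "real^'n" where v: "v \<noteq> 0" "(\<Sum>i\<in>UNIV. v $ i) = 0" "(\<Sum>i\<in>UNIV. v $ i *\<^sub>R x $ i) = 0"
    and basis: "\<And>u. (\<Sum>i\<in>UNIV. u $ i *\<^sub>R x $ i) = 0 \<Longrightarrow> \<exists>\<alpha> \<beta>. \<forall>j. u $ j = \<alpha> + \<beta> * v $ j"
    by (rule linear_relations_basis[OF assms(4,5) sum0]) (rule that)
  define B :: "'n \<Rightarrow> real^'n"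
    where "B i = (\<chi> k. if k = i then m - (\<Sum>k\<in>-{i}. a i k) else a i k)" for i
  have split: "(\<Sum>k\<in>UNIV. f k) = f i + (\<Sum>k\<in>-{i}. f k)" for f :: "'n \<Rightarrow> 'b::comm_monoid_add" and i
    by (simp add: sum.remove[of UNIV i] Compl_eq_Diff_UNIV)
  have off: "(\<Sum>k\<in>-{i}. h (B i $ k) k) = (\<Sum>k\<in>-{i}. h (a i k) k)"
    for h :: "real \<Rightarrow> 'n \<Rightarrow> 'b::comm_monoid_add" and i
    by (intro sum.cong) (auto simp: B_def)
  have "(\<Sum>k\<in>UNIV. B i $ k *\<^sub>R x $ k) = 0" for i
  proof -
    have "(\<Sum>k\<in>UNIV. B i $ k *\<^sub>R x $ k)
        = (m - (\<Sum>k\<in>-{i}. a i k)) *\<^sub>R x $ i + (\<Sum>k\<in>-{i}. a i k *\<^sub>R x $ k)"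
      unfolding split[of _ i] off[of "\<lambda>b k. b *\<^sub>R x $ k"] by (simp add: B_def)
    moreover have "(\<Sum>k\<in>-{i}. a i k) *\<^sub>R x $ i - (\<Sum>k\<in>-{i}. a i k *\<^sub>R x $ k) = m *\<^sub>R x $ i"
      using balance[of i] by (simp add: scaleR_diff_right sum_subtractf scaleR_sum_left)
    ultimately show ?thesis by (simp add: algebra_simps)
  qed
  then have "\<forall>i. \<exists>\<alpha> \<beta>. \<forall>k. B i $ k = \<alpha> + \<beta> * v $ k"
    using basis by simp
  then obtain \<alpha> \<beta> where B: "B i $ k = \<alpha> i + \<beta> i * v $ k" for i k
    by metis
  have \<alpha>: "\<alpha> i = m / real CARD('n)" for i
  proof -
    have "(\<Sum>k\<in>UNIV. B i $ k) = m"
      unfolding split[of _ i] off[of "\<lambda>b k. b"] by (simp add: B_def)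
    moreover have "(\<Sum>k\<in>UNIV. B i $ k) = real CARD('n) * \<alpha> i"
      by (simp add: B sum.distrib sum_distrib_left[symmetric] v(2))
    ultimately show ?thesis by (simp add: field_simps)
  qed
  obtain l where l: "v $ l \<noteq> 0" using v(1) by (auto simp: vec_eq_iff)
  have "B i $ l = B l $ i" for i
    using sym[of i l] by (auto simp: B_def)
  then have "\<beta> i * v $ l = \<beta> l * v $ i" for i
    by (simp add: B \<alpha>)
  then have \<beta>: "\<beta> i = \<beta> l / v $ l * v $ i" for i
    using l by (simp add: field_simps)
  define \<mu> where "\<mu> = \<beta> l / v $ l * (real CARD('n) / m)"
  have "a i k = m / real CARD('n) * (1 + \<mu> * (v $ i * v $ k))" if "i \<noteq> k" for i k
  proof -
    have "a i k = m / real CARD('n) + \<beta> l / v $ l * v $ i * v $ k"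
      using B[of i k] \<alpha>[of i] \<beta>[of i] that by (simp add: B_def)
    also have "\<dots> = m / real CARD('n) * (1 + \<mu> * (v $ i * v $ k))"
      using \<open>m \<noteq> 0\<close> by (simp add: \<mu>_def distrib_left)
    finally show ?thesis .
  qed
  then show thesis using that v by blast
qed

section \<open>The weights take two values\<close>

text \<open>
  Expand \<open>1 / (1 + y) = 1 - y + y\<^sup>2 / (1 + y)\<close> with \<open>y = \<mu> * v i * v j\<close>; the constant terms already
  add up to the right-hand side, and the linear terms add up to \<open>\<mu> * (v i)\<^sup>2\<close> because the
  weights have sum zero.
\<close>

lemma weights_second_order:
  fixes v :: "'n::finite \<Rightarrow> real"
  assumes "(\<Sum>j\<in>UNIV. v j) = 0"
    and "\<And>j. j \<noteq> i \<Longrightarrow> 1 + \<mu> * (v i * v j) \<noteq> 0"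
    and "(\<Sum>j\<in>-{i}. 1 / (1 + \<mu> * (v i * v j))) = real CARD('n) - 1"
  shows "(\<Sum>j\<in>-{i}. (\<mu> * (v i * v j))\<^sup>2 / (1 + \<mu> * (v i * v j))) = - (\<mu> * (v i)\<^sup>2)"
proof -
  have "1 / (1 + \<mu> * (v i * v j)) = 1 - \<mu> * (v i * v j) + (\<mu> * (v i * v j))\<^sup>2 / (1 + \<mu> * (v i * v j))"
    if "j \<in> -{i}" for j
    using assms(2)[of j] that by (auto simp: divide_simps power2_eq_square algebra_simps)
  then have "real CARD('n) - 1 = (\<Sum>j\<in>-{i}. 1 - \<mu> * (v i * v j)
      + (\<mu> * (v i * v j))\<^sup>2 / (1 + \<mu> * (v i * v j)))"
    unfolding assms(3)[symmetric] by (intro sum.cong) auto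
  also have "\<dots> = real (card (-{i})) - \<mu> * (v i * (\<Sum>j\<in>-{i}. v j))
      + (\<Sum>j\<in>-{i}. (\<mu> * (v i * v j))\<^sup>2 / (1 + \<mu> * (v i * v j)))"
    by (simp add: sum.distrib sum_subtractf sum_distrib_left)
  also have "(\<Sum>j\<in>-{i}. v j) = - v i"
    using assms(1) by (simp add: sum.remove[of UNIV i] Compl_eq_Diff_UNIV add_eq_0_iff)
  also have "real (card (-{i})) = real CARD('n) - 1"
    by (simp add: Compl_eq_Diff_UNIV card_Diff_subset Suc_leI of_nat_diff)
  finally show ?thesis by (simp add: power2_eq_square)
qed

text \<open>
  If \<open>(w i)\<^sup>2 \<ge> 1\<close>, then no other weight can have the sign of \<open>w i\<close>, since the term of \<open>w i\<close> in its
  equation alone would exceed 1.  But then all denominators in the equation of \<open>w i\<close> exceed 1, and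
  its left-hand side is too small.
\<close>

lemma weights_less_one:
  fixes w :: "'n::finite \<Rightarrow> real"
  assumes "CARD('n) \<ge> 2"
    and sum0: "(\<Sum>j\<in>UNIV. w j) = 0"
    and nz: "\<And>j. w j \<noteq> 0"
    and pos: "\<And>j k. j \<noteq> k \<Longrightarrow> w j * w k < 1"
    and eq: "\<And>j. (\<Sum>k\<in>-{j}. (w k)\<^sup>2 / (1 - w j * w k)) = 1"
  shows "(w i)\<^sup>2 < 1"
proof (rule ccontr)
  assume "\<not> (w i)\<^sup>2 < 1"
  then have big: "(w i)\<^sup>2 \<ge> 1" by simp
  have neg: "w i * w j < 0" if "j \<noteq> i" for j
  proof (rule ccontr)
    assume "\<not> w i * w j < 0"
    then have "0 < w i * w j"
      using nz by (metis linorder_neqE_linordered_idom mult_eq_0_iff)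
    then have "1 - w j * w i < (w i)\<^sup>2" and "0 < 1 - w j * w i"
      using pos[of i j] that big by (auto simp: mult.commute)
    then have "1 < (w i)\<^sup>2 / (1 - w j * w i)" by simp
    also have "\<dots> \<le> (\<Sum>k\<in>-{j}. (w k)\<^sup>2 / (1 - w j * w k))"
      using that pos[of j] by (intro member_le_sum) (auto simp: less_imp_le)
    finally show False using eq by simp
  qed
  have "card (-{i}) = CARD('n) - 1"
    by (simp add: Compl_eq_Diff_UNIV card_Diff_subset)
  then have ne: "-{i} \<noteq> {}" using assms(1) by fastforce
  have "(w i)\<^sup>2 = (w i)\<^sup>2 * (\<Sum>k\<in>-{i}. (w k)\<^sup>2 / (1 - w i * w k))"
    by (simp add: eq)
  also have "\<dots> = (\<Sum>k\<in>-{i}. (w i * w k)\<^sup>2 / (1 - w i * w k))"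
    by (simp add: sum_distrib_left power_mult_distrib)
  also have "\<dots> < (\<Sum>k\<in>-{i}. - (w i * w k))"
  proof (intro sum_strict_mono ne)
    fix k assume "k \<in> -{i}"
    then show "(w i * w k)\<^sup>2 / (1 - w i * w k) < - (w i * w k)"
      using neg[of k] by (simp add: divide_less_eq power2_eq_square algebra_simps)
  qed simp
  also have "\<dots> = - (w i * (\<Sum>k\<in>-{i}. w k))"
    by (simp add: sum_negf sum_distrib_left)
  also have "(\<Sum>k\<in>-{i}. w k) = - w i"
    using sum0 by (simp add: sum.remove[of UNIV i] Compl_eq_Diff_UNIV add_eq_0_iff)
  finally show False by (simp add: power2_eq_square)
qed

text \<open>
  The function \<open>t \<mapsto> 1 / (1 - t * w)\<close> is strictly convex where \<open>t * w < 1\<close>, and the identity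
  computes its second divided difference exactly.
\<close>

lemma inverse_linear_divided_difference:
  fixes a b c w :: real
  assumes "1 - a * w \<noteq> 0" "1 - b * w \<noteq> 0" "1 - c * w \<noteq> 0"
  shows "(b - c) / (1 - a * w) + (c - a) / (1 - b * w) + (a - b) / (1 - c * w)
    = (a - b) * (b - c) * (a - c) * (w\<^sup>2 / ((1 - a * w) * (1 - b * w) * (1 - c * w)))"
  using assms by (simp add: divide_simps) algebra

text \<open>
  A strictly convex function takes no value three times.
\<close>

lemma convex_pole_sum_at_most_two_solutions:
  fixes r w :: "'n::finite \<Rightarrow> real"
  assumes "\<And>j. r j > 0" and "\<And>j. w j \<noteq> 0"
    and den: "\<And>t j. t \<in> {a, b, c} \<Longrightarrow> t * w j < 1"
    and eq: "\<And>t. t \<in> {a, b, c} \<Longrightarrow> (\<Sum>j\<in>UNIV. r j / (1 - t * w j)) = m"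
  shows "a = b \<or> b = c \<or> a = c"
proof -
  let ?q = "\<lambda>j. (w j)\<^sup>2 / ((1 - a * w j) * (1 - b * w j) * (1 - c * w j))"
  have d: "1 - a * w j > 0" "1 - b * w j > 0" "1 - c * w j > 0" for j
    using den[of a j] den[of b j] den[of c j] by auto
  have "0 = (b - c) * m + (c - a) * m + (a - b) * m" by (simp add: algebra_simps)
  also have "\<dots> = (b - c) * (\<Sum>j\<in>UNIV. r j / (1 - a * w j))
      + (c - a) * (\<Sum>j\<in>UNIV. r j / (1 - b * w j)) + (a - b) * (\<Sum>j\<in>UNIV. r j / (1 - c * w j))"
    using eq by simp
  also have "\<dots> = (\<Sum>j\<in>UNIV. r j * ((b - c) / (1 - a * w j) + (c - a) / (1 - b * w j)
      + (a - b) / (1 - c * w j)))"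
    by (simp add: sum_distrib_left sum.distrib distrib_left mult.commute)
  also have "\<dots> = (\<Sum>j\<in>UNIV. r j * ((a - b) * (b - c) * (a - c) * ?q j))"
    using d by (intro sum.cong refl, subst inverse_linear_divided_difference) (auto simp: less_le)
  also have "\<dots> = (a - b) * (b - c) * (a - c) * (\<Sum>j\<in>UNIV. r j * ?q j)"
    by (simp add: sum_distrib_left mult.commute mult.left_commute)
  finally have "(a - b) * (b - c) * (a - c) * (\<Sum>j\<in>UNIV. r j * ?q j) = 0" by simp
  moreover have "(\<Sum>j\<in>UNIV. r j * ?q j) > 0"
    using assms(1,2) d by (intro sum_pos mult_pos_pos divide_pos_pos) auto
  ultimately show ?thesis by auto
qed

text \<open>
  Every weight \<open>t = w i\<close> solves \<open>(\<Sum>j. (1 - (w j)\<^sup>2) / (1 - t * w j)) = CARD('n) - 1\<close>: the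
  summand \<open>j = i\<close> is 1, and the others are differences of the summands in the two equations
  satisfied by \<open>w i\<close>.  By \<open>weights_less_one\<close> all numerators are positive, so the left-hand
  side is a strictly convex function of \<open>t\<close>.
\<close>

lemma weights_two_valued:
  fixes w :: "'n::finite \<Rightarrow> real"
  assumes card: "CARD('n) \<ge> 2"
    and sum0: "(\<Sum>j\<in>UNIV. w j) = 0"
    and nz: "\<And>j. w j \<noteq> 0"
    and pos: "\<And>j k. j \<noteq> k \<Longrightarrow> w j * w k < 1"
    and eq: "\<And>i. (\<Sum>j\<in>-{i}. 1 / (1 - w i * w j)) = real CARD('n) - 1"
  obtains p q where "q < 0" "0 < p" "range w = {p, q}"
proof -
  have eq2: "(\<Sum>j\<in>-{i}. (w j)\<^sup>2 / (1 - w i * w j)) = 1" for i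
  proof -
    have "(\<Sum>j\<in>-{i}. (-1 * (w i * w j))\<^sup>2 / (1 + -1 * (w i * w j))) = - (-1 * (w i)\<^sup>2)"
      using pos[of i] eq[of i] by (intro weights_second_order sum0) (fastforce simp: mult.commute)+
    then have "(w i)\<^sup>2 * (\<Sum>j\<in>-{i}. (w j)\<^sup>2 / (1 - w i * w j)) = (w i)\<^sup>2"
      by (simp add: sum_distrib_left power_mult_distrib)
    then show ?thesis using nz[of i] by simp
  qed
  have lt1: "(w i)\<^sup>2 < 1" for i
    by (rule weights_less_one[OF card sum0 nz pos eq2])
  have den: "w i * w j < 1" for i j
    using pos[of i j] lt1[of i] by (cases "i = j") (auto simp: power2_eq_square)
  have eq3: "(\<Sum>j\<in>UNIV. (1 - (w j)\<^sup>2) / (1 - w i * w j)) = real CARD('n) - 1" for i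
  proof -
    have "(\<Sum>j\<in>UNIV. (1 - (w j)\<^sup>2) / (1 - w i * w j))
        = (1 - (w i)\<^sup>2) / (1 - w i * w i) + (\<Sum>j\<in>-{i}. (1 - (w j)\<^sup>2) / (1 - w i * w j))"
      by (simp add: sum.remove[of UNIV i] Compl_eq_Diff_UNIV)
    also have "(1 - (w i)\<^sup>2) / (1 - w i * w i) = 1"
      using lt1[of i] by (simp add: power2_eq_square)
    also have "(\<Sum>j\<in>-{i}. (1 - (w j)\<^sup>2) / (1 - w i * w j)) = real CARD('n) - 1 - 1"
      by (simp add: diff_divide_distrib sum_subtractf eq eq2)
    finally show ?thesis by simp
  qed
  have "\<exists>i. w i < 0"
  proof (rule ccontr)
    assume "\<nexists>i. w i < 0"
    then have "w j > 0" for j using nz by (metis linorder_neqE_linordered_idom)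
    then have "(\<Sum>j\<in>UNIV. w j) > 0" by (intro sum_pos) auto
    then show False using sum0 by simp
  qed
  then obtain i where i: "w i < 0" by blast
  have "\<exists>k. 0 < w k"
  proof (rule ccontr)
    assume "\<nexists>k. 0 < w k"
    then have "- w j > 0" for j using nz by (metis linorder_neqE_linordered_idom neg_0_less_iff_less)
    then have "(\<Sum>j\<in>UNIV. - w j) > 0" by (intro sum_pos) auto
    then show False using sum0 by (simp add: sum_negf)
  qed
  then obtain k where k: "0 < w k" by blast
  have "w j \<in> {w k, w i}" for j
  proof -
    have "w k = w i \<or> w i = w j \<or> w k = w j"
      using lt1 nz den eq3
      by (intro convex_pole_sum_at_most_two_solutions[of "\<lambda>j. 1 - (w j)\<^sup>2" w]) auto
    then show ?thesis using i k by auto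
  qed
  then have "range w = {w k, w i}" by auto
  then show thesis using that i k by blast
qed

section \<open>Splitting the configuration\<close>

lemma equidistant_if_inner_constant:
  fixes x :: "('a::real_inner)^'n"
  assumes "\<And>j. norm (x $ j) = 1" and "\<And>j. j \<noteq> i \<Longrightarrow> x $ i \<bullet> x $ j = r"
  shows "equidistant_to_others (x $ i) (range (\<lambda>j. x $ j))"
proof -
  have "dist (x $ i) y = sqrt (2 * (1 - r))" if "y \<in> range (\<lambda>j. x $ j) - {x $ i}" for y
  proof -
    obtain j where "y = x $ j" "j \<noteq> i" using \<open>y \<in> _\<close> by auto
    then have "(dist (x $ i) y)\<^sup>2 = 2 * (1 - r)"
      using assms by (simp add: dist_norm norm_diff_unit)
    then show ?thesis by (metis real_sqrt_unique zero_le_dist)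
  qed
  then show ?thesis unfolding equidistant_to_others_def by blast
qed

lemma regular_simplex_if_inner_constant:
  fixes x :: "('a::real_inner)^'n"
  assumes "\<And>j. norm (x $ j) = 1" and "I \<noteq> {}"
    and "\<And>j k. j \<in> I \<Longrightarrow> k \<in> I \<Longrightarrow> j \<noteq> k \<Longrightarrow> x $ j \<bullet> x $ k = r"
  shows "regular_simplex ((\<lambda>j. x $ j) ` I)"
proof -
  have "dist (x $ j) (x $ k) = sqrt (2 * (1 - r))" if "j \<in> I" "k \<in> I" "x $ j \<noteq> x $ k" for j k
  proof -
    have "(dist (x $ j) (x $ k))\<^sup>2 = 2 * (1 - r)"
      using assms that by (metis dist_norm norm_diff_unit)
    then show ?thesis by (metis real_sqrt_unique zero_le_dist)
  qed
  then show ?thesis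
    using assms(2) unfolding regular_simplex_def by auto
qed

text \<open>
  The two relations between the points have different coefficients on the two classes, so each
  class has sum zero.  As the points of one class have a common inner product with those of the
  other one, this inner product vanishes.
\<close>

lemma two_valued_weights_split:
  fixes x :: "('a::real_inner)^'n" and w :: "'n \<Rightarrow> real"
  assumes inj: "inj (\<lambda>i. x $ i)"
    and unit: "\<And>i. norm (x $ i) = 1"
    and sum0: "(\<Sum>i\<in>UNIV. x $ i) = 0"
    and wsum0: "(\<Sum>i\<in>UNIV. w i *\<^sub>R x $ i) = 0"
    and inner: "\<And>i j. i \<noteq> j \<Longrightarrow> x $ i \<bullet> x $ j = g (w i * w j)"
    and range: "range w = {p, q}" and "p \<noteq> q"
  shows "\<exists>Y Z. Y \<union> Z = range (\<lambda>i. x $ i) \<and> Y \<inter> Z = {} \<and>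
    regular_simplex Y \<and> regular_simplex Z \<and> orthogonal_sets Y Z \<and>
    center_of_mass Y = 0 \<and> center_of_mass Z = 0"
proof -
  define I where "I s = {i. w i = s}" for s
  have I: "I p \<union> I q = UNIV" "I p \<inter> I q = {}"
    using range \<open>p \<noteq> q\<close> by (auto simp: I_def)
  have ne: "I p \<noteq> {}" "I q \<noteq> {}"
  proof -
    have "p \<in> range w" "q \<in> range w" by (simp_all add: range)
    then show "I p \<noteq> {}" "I q \<noteq> {}" by (auto simp: I_def)
  qed
  let ?S = "\<lambda>s. \<Sum>i\<in>I s. x $ i"
  have split: "(\<Sum>i\<in>UNIV. f i) = (\<Sum>i\<in>I p. f i) + (\<Sum>i\<in>I q. f i)" for f :: "'n \<Rightarrow> 'a"
    using sum.union_disjoint[of "I p" "I q" f] I by simp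
  have S: "?S p + ?S q = 0"
    using sum0 by (simp add: split)
  have "p *\<^sub>R ?S p + q *\<^sub>R ?S q = 0"
    using wsum0 by (simp add: split scaleR_sum_right I_def)
  then have "(p - q) *\<^sub>R ?S p + q *\<^sub>R (?S p + ?S q) = 0"
    by (simp add: algebra_simps)
  then have Sp: "?S p = 0" using S \<open>p \<noteq> q\<close> by simp
  then have Sq: "?S q = 0" using S by simp
  have "x $ i \<bullet> x $ j = 0" if "i \<in> I p" "j \<in> I q" for i j
  proof -
    have "real (card (I q)) * g (p * q) = (\<Sum>k\<in>I q. x $ i \<bullet> x $ k)"
    proof -
      have "x $ i \<bullet> x $ k = g (p * q)" if "k \<in> I q" for k
        using inner[of i k] \<open>i \<in> I p\<close> that \<open>p \<noteq> q\<close> by (auto simp: I_def)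
      then show ?thesis by simp
    qed
    also have "\<dots> = x $ i \<bullet> ?S q" by (simp add: inner_sum_right)
    finally have "g (p * q) = 0" using Sq ne(2) by simp
    then show ?thesis using that \<open>p \<noteq> q\<close> by (subst inner) (auto simp: I_def)
  qed
  then have "orthogonal_sets ((\<lambda>i. x $ i) ` I p) ((\<lambda>i. x $ i) ` I q)"
    by (auto simp: orthogonal_sets_def)
  moreover have "regular_simplex ((\<lambda>i. x $ i) ` I s)" if "I s \<noteq> {}" for s
    using that by (intro regular_simplex_if_inner_constant[where r = "g (s * s)"])
      (auto simp: I_def inner unit)
  moreover have "center_of_mass ((\<lambda>i. x $ i) ` I s) = 0" if "?S s = 0" for s
    using that inj by (simp add: center_of_mass_def sum.reindex inj_on_subset[OF inj])
  moreover have "(\<lambda>i. x $ i) ` I p \<union> (\<lambda>i. x $ i) ` I q = range (\<lambda>i. x $ i)"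
    by (simp add: image_Un[symmetric] I)
  moreover have "(\<lambda>i. x $ i) ` I p \<inter> (\<lambda>i. x $ i) ` I q = {}"
    using I by (simp add: image_Int[OF inj, symmetric])
  ultimately show ?thesis using Sp Sq ne by blast
qed

theorem theorem2p1:
  fixes x :: "(real^'d)^'n" and X :: "(real^'d) set"
  assumes "CARD('d) \<ge> 2"
    and "CARD('n) = CARD('d) + 2"
    and "X = range (\<lambda>i. x $ i)"
    and "stationary_log_configuration x"
    and "non_degenerate X"
    and "\<not> (\<exists>p\<in>X. equidistant_to_others p X)"
  shows "\<exists>Y Z. Y \<union> Z = X \<and> Y \<inter> Z = {} \<and>
           regular_simplex Y \<and> regular_simplex Z \<and>
           orthogonal_sets Y Z \<and>
           center_of_mass Y = 0 \<and> center_of_mass Z = 0"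
proof -
  have inj: "inj (\<lambda>i. x $ i)" and unit: "norm (x $ i) = 1" for i
    using assms(4) by (auto simp: stationary_log_configuration_def critical_point_on_def
        sphere_power_def)
  let ?N = "real CARD('n)"
  define a where "a i k = 1 / (1 - x $ i \<bullet> x $ k)" for i k
  have sym: "a i k = a k i" for i k by (simp add: a_def inner_commute)
  have balance: "(\<Sum>k\<in>-{i}. a i k *\<^sub>R (x $ i - x $ k)) = (?N - 1) *\<^sub>R x $ i" for i
    unfolding a_def by (rule stationary_balance[OF assms(4)])
  have N1: "?N - 1 > 0" using assms(1,2) by simp
  have sum0: "(\<Sum>i\<in>UNIV. x $ i) = 0"
    using balanced_sum_zero[OF sym _ balance] N1 by simp
  have "span (range (\<lambda>i. x $ i)) = UNIV"
    using assms(3,5) by (simp add: non_degenerate_def)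
  from balanced_couplings_rank_one[OF sym balance _ this assms(2)] N1
  obtain v :: "real^'n" and \<mu> where v: "(\<Sum>i\<in>UNIV. v $ i) = 0"
      "(\<Sum>i\<in>UNIV. v $ i *\<^sub>R x $ i) = 0"
    and a: "\<And>i k. i \<noteq> k \<Longrightarrow> a i k = (?N - 1) / ?N * (1 + \<mu> * (v $ i * v $ k))"
    by auto
  define g where "g s = 1 - ?N / (?N - 1) / (1 + \<mu> * s)" for s
  have dpos: "1 + \<mu> * (v $ i * v $ k) > 0" and inner: "x $ i \<bullet> x $ k = g (v $ i * v $ k)"
    if "i \<noteq> k" for i k
  proof -
    have lt: "x $ i \<bullet> x $ k < 1"
      using inj that by (intro inner_less_one_if_unit unit) (auto simp: inj_eq)
    then have "0 < a i k" by (simp add: a_def)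
    then show "1 + \<mu> * (v $ i * v $ k) > 0"
      using a[OF that] N1 by (simp add: zero_less_mult_iff zero_less_divide_iff)
    have "1 - x $ i \<bullet> x $ k = 1 / a i k" by (simp add: a_def)
    also have "\<dots> = ?N / (?N - 1) / (1 + \<mu> * (v $ i * v $ k))"
      by (simp add: a[OF that])
    finally show "x $ i \<bullet> x $ k = g (v $ i * v $ k)" by (simp add: g_def)
  qed
  \<comment> \<open>A vanishing weight \<open>v $ i\<close> makes \<open>x $ i\<close> equidistant to all others, and \<open>\<mu> = 0\<close> does so
    for every point.\<close>
  have not_const: False if "\<And>j. j \<noteq> i \<Longrightarrow> x $ i \<bullet> x $ j = r" for i r
    using equidistant_if_inner_constant[OF unit that] assms(3,6) by blast
  have vnz: "v $ i \<noteq> 0" for i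
    using not_const[of i "g 0"] inner by fastforce
  have "\<mu> \<noteq> 0"
    using not_const[of _ "g 0"] inner by (fastforce simp: g_def)
  \<comment> \<open>This is \<open>x $ i \<bullet> (\<Sum>j\<in>UNIV. x $ j) = 0\<close>, rewritten in terms of the weights.\<close>
  have eq: "(\<Sum>j\<in>-{i}. 1 / (1 + \<mu> * (v $ i * v $ j))) = ?N - 1" for i
  proof -
    have "0 = x $ i \<bullet> (\<Sum>j\<in>UNIV. x $ j)" by (simp add: sum0)
    also have "\<dots> = x $ i \<bullet> x $ i + (\<Sum>j\<in>-{i}. x $ i \<bullet> x $ j)"
      by (simp add: sum.remove[of UNIV i] Compl_eq_Diff_UNIV inner_add_right inner_sum_right)
    also have "x $ i \<bullet> x $ i = 1" using unit[of i] by (simp add: norm_eq_1)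
    also have "(\<Sum>j\<in>-{i}. x $ i \<bullet> x $ j)
        = (\<Sum>j\<in>-{i}. 1 - ?N / (?N - 1) * (1 / (1 + \<mu> * (v $ i * v $ j))))"
      by (intro sum.cong refl) (subst inner, auto simp: g_def)
    also have "\<dots> = real (card (-{i})) - ?N / (?N - 1) * (\<Sum>j\<in>-{i}. 1 / (1 + \<mu> * (v $ i * v $ j)))"
      by (simp add: sum_subtractf sum_distrib_left)
    also have "real (card (-{i})) = ?N - 1"
      by (simp add: Compl_eq_Diff_UNIV card_Diff_subset Suc_leI of_nat_diff)
    finally have "?N * (\<Sum>j\<in>-{i}. 1 / (1 + \<mu> * (v $ i * v $ j))) = ?N * (?N - 1)"
      using N1 by (simp add: field_simps)
    then show ?thesis by simp
  qed
  have "\<mu> < 0"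
  proof (rule ccontr)
    fix i :: 'n
    assume "\<not> \<mu> < 0"
    then have "\<mu> * (v $ i)\<^sup>2 > 0" using \<open>\<mu> \<noteq> 0\<close> vnz[of i] by simp
    moreover have "0 \<le> (\<Sum>j\<in>-{i}. (\<mu> * (v $ i * v $ j))\<^sup>2 / (1 + \<mu> * (v $ i * v $ j)))"
      using dpos[of i] by (intro sum_nonneg divide_nonneg_nonneg) (auto simp: less_imp_le)
    then have "0 \<le> - (\<mu> * (v $ i)\<^sup>2)"
      using weights_second_order[of "\<lambda>j. v $ j" i \<mu>] v(1) dpos[of i] eq[of i] by fastforce
    ultimately show False by simp
  qed
  \<comment> \<open>Rescale so that the couplings become proportional to \<open>1 - w i * w j\<close>.\<close>
  define w where "w i = sqrt (- \<mu>) * v $ i" for i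
  have ww: "w i * w j = - (\<mu> * (v $ i * v $ j))" for i j
  proof -
    have "w i * w j = (sqrt (- \<mu>) * sqrt (- \<mu>)) * (v $ i * v $ j)" by (simp add: w_def)
    then show ?thesis using \<open>\<mu> < 0\<close> by simp
  qed
  have "(\<Sum>j\<in>UNIV. w j) = 0"
    using v(1) by (simp add: w_def sum_distrib_left[symmetric])
  moreover have "w j \<noteq> 0" for j using vnz \<open>\<mu> < 0\<close> by (simp add: w_def)
  moreover have "w j * w k < 1" if "j \<noteq> k" for j k using dpos[OF that] by (simp add: ww)
  moreover have "(\<Sum>j\<in>-{i}. 1 / (1 - w i * w j)) = ?N - 1" for i using eq[of i] by (simp add: ww)
  ultimately obtain p q where "q < 0" "0 < p" and range: "range w = {p, q}"
    using weights_two_valued[of w] assms(2) by (metis le_add2)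
  have "(\<Sum>i\<in>UNIV. w i *\<^sub>R x $ i) = 0"
    using v(2) by (simp add: w_def scaleR_sum_right[symmetric] scaleR_scaleR[symmetric]
        del: scaleR_scaleR)
  moreover have "x $ i \<bullet> x $ j = g (w i * w j / - \<mu>)" if "i \<noteq> j" for i j
    using inner[OF that] \<open>\<mu> < 0\<close> by (simp add: ww)
  ultimately show ?thesis
    unfolding assms(3) using \<open>q < 0\<close> \<open>0 < p\<close>
    by (intro two_valued_weights_split[where w = w and g = "\<lambda>s. g (s / - \<mu>)", OF inj unit sum0 _ _ range])
      auto
qed

end
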